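(* Let $V\subseteq\mathbb{R}^n$ be a nonempty bounded set of vectors. Then the set function $\phi:2^{[n]}\to\mathbb{R}$ defined by $$\phi(A)=\frac{1}{n}\,\mathbb{E}_{\sigma\sim\{-1,1\}^A}\Big[\sup_{v\in V}\sum_{i\in A}\sigma_i v_i\Big]$$ (with $\sigma$ uniform on $\{-1,1\}^A$) is XOS.
   Context: A set function $f:2^{[n]}\to\mathbb{R}$ is XOS if there is a nonempty finite set $C$ and nonnegative weights $w_{ci}\ge0$ ($c\in C$, $i\in[n]$) such that $f(A)=\max_{c\in C}\sum_{i\in A}w_{ci}$ for all $A\subseteq[n]$. *)

theory Defs
  imports "HOL-Probability.Probability"
begin

(* The ground set [n] is the finite index type 'n. Since HOL cannot quantify over types inside a
   formula, the finite index set C is taken, without loss of generality, to be a set of naturals. *)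
definition XOS :: "('n::finite set \<Rightarrow> real) \<Rightarrow> bool" where
  "XOS f \<longleftrightarrow>
     (\<exists>(C :: nat set) (w :: nat \<Rightarrow> 'n \<Rightarrow> real).
        finite C \<and> C \<noteq> {} \<and> (\<forall>c\<in>C. \<forall>i. 0 \<le> w c i) \<and>
        (\<forall>A. f A = Max ((\<lambda>c. \<Sum>i\<in>A. w c i) ` C)))"

(* The sign vectors on A, as extensional functions: they are undefined off A, so that the set
   has exactly 2 ^ card A elements (one element when A is empty). *)
definition sign_vectors :: "'n set \<Rightarrow> ('n \<Rightarrow> real) set" where
  "sign_vectors A = A \<rightarrow>\<^sub>E {-1, 1}"

(* The supremum is the real one, hence meaningful only for nonempty bounded V. *)
definition rademacher :: "(real ^ 'n::finite) set \<Rightarrow> 'n set \<Rightarrow> real" where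
  "rademacher V A =
     1 / real CARD('n) *
     measure_pmf.expectation (pmf_of_set (sign_vectors A))
       (\<lambda>\<sigma>. SUP v\<in>V. \<Sum>i\<in>A. \<sigma> i * v $ i)"

end

theory Submission
  imports Defs
begin

text \<open>Let \<open>h s = sup\<^bsub>v \<in> V\<^esub> s \<bullet> v\<close>, and choose for each \<open>s\<close> a maximiser \<open>g s\<close> in the closure of
  \<open>V\<close>. Averaging over sign vectors \<open>\<sigma>\<close> on the whole ground set, and writing \<open>\<sigma>\<^sub>A\<close> for \<open>\<sigma>\<close> set to zero
  off \<open>A\<close>, the weights \<open>w\<^sub>i = (1/n) E[\<sigma>\<^sub>i (g \<sigma>\<^sub>A)\<^sub>i]\<close> support \<open>\<phi>\<close> at \<open>A\<close>: the sum of \<open>w\<close> over \<open>B\<close> is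
  \<open>(1/n) E[\<sigma>\<^sub>B \<bullet> g \<sigma>\<^sub>A] \<le> (1/n) E[h \<sigma>\<^sub>B] = \<phi>(B)\<close>, with equality for \<open>B = A\<close>. They are nonnegative because
  \<open>g\<close> is monotone, \<open>(s - t) \<bullet> (g s - g t) \<ge> 0\<close>: apply this to \<open>\<sigma>\<close> and \<open>\<sigma>\<close> with its \<open>i\<close>-th sign flipped.\<close>

text \<open>Take one clause per set: at \<open>A\<close>, the clause chosen for \<open>A\<close>
  attains \<open>f A\<close> and no other clause exceeds it. The injection \<open>e\<close> only
  numbers the sets.\<close>

lemma XOS_if_supporting_weights:
  fixes f :: "'n::finite set \<Rightarrow> real"
  assumes "\<And>A. \<exists>w. (\<forall>i. 0 \<le> w i) \<and> (\<Sum>i\<in>A. w i) = f A \<and> (\<forall>B. (\<Sum>i\<in>B. w i) \<le> f B)"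
  shows "XOS f"
proof -
  obtain W where W: "\<And>A i. 0 \<le> W A i" "\<And>A. (\<Sum>i\<in>A. W A i) = f A"
    "\<And>A B. (\<Sum>i\<in>B. W A i) \<le> f B"
    using assms by metis
  obtain e :: "'n set \<Rightarrow> nat" where "inj e"
    using finite_imp_inj_to_nat_seg[of "UNIV :: 'n set set"] by auto
  define w where "w c = W (inv e c)" for c
  have "f A = Max ((\<lambda>c. \<Sum>i\<in>A. w c i) ` range e)" for A
    by (rule Max_eqI[symmetric]) (auto simp: w_def W \<open>inj e\<close> image_iff intro!: exI[of _ A])
  then show ?thesis
    unfolding XOS_def using W(1) by (intro exI[of _ "range e"] exI[of _ w]) (auto simp: w_def)
qed

definition mask :: "'n set \<Rightarrow> ('n \<Rightarrow> real) \<Rightarrow> real ^ 'n" where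
  "mask A \<sigma> = (\<chi> i. if i \<in> A then \<sigma> i else 0)"

lemma mask_inner: "mask A \<sigma> \<bullet> v = (\<Sum>i\<in>A. \<sigma> i * v $ i)"
  by (simp add: mask_def inner_vec_def if_distrib[of "\<lambda>x. x * _"] sum.If_cases)

text \<open>\<open>V\<close> need not be closed, so the supremum may be attained only on its
  closure, which is compact; the upper bound extends there by continuity.\<close>

lemma support_function_maximiser:
  fixes V :: "'a::euclidean_space set"
  assumes "V \<noteq> {}" and "bounded V"
  obtains g where "\<And>s. s \<bullet> g s = (SUP v\<in>V. s \<bullet> v)" "\<And>s t. t \<bullet> g s \<le> (SUP v\<in>V. t \<bullet> v)"
proof -
  have bdd: "bdd_above ((\<bullet>) t ` V)" for t :: 'a
    by (intro bounded_imp_bdd_above bounded_linear_image assms bounded_linear_inner_right)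
  have le: "t \<bullet> u \<le> (SUP v\<in>V. t \<bullet> v)" if "u \<in> closure V" for t u
    by (rule continuous_le_on_closure[OF _ that, where f = "(\<bullet>) t"])
      (auto intro!: continuous_intros cSUP_upper bdd)
  have "\<exists>u\<in>closure V. s \<bullet> u = (SUP v\<in>V. s \<bullet> v)" for s
  proof -
    have "\<exists>u\<in>closure V. \<forall>v\<in>closure V. s \<bullet> v \<le> s \<bullet> u"
      using assms by (intro continuous_attains_sup) (auto intro!: continuous_intros)
    then obtain u where u: "u \<in> closure V" "\<And>v. v \<in> closure V \<Longrightarrow> s \<bullet> v \<le> s \<bullet> u"
      by blast
    have "(SUP v\<in>V. s \<bullet> v) \<le> s \<bullet> u"
      using u(2) closure_subset assms(1) by (intro cSUP_least) auto
    with le[OF u(1)] u(1) show ?thesis by (metis antisym)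
  qed
  then obtain g where "\<And>s. g s \<in> closure V \<and> s \<bullet> g s = (SUP v\<in>V. s \<bullet> v)"
    by metis
  with le that show ?thesis by blast
qed

lemma finite_sign_vectors: "finite (sign_vectors (A :: 'n::finite set))"
  by (simp add: sign_vectors_def finite_PiE)

lemma sign_vectors_nonempty: "sign_vectors A \<noteq> {}"
  by (simp add: sign_vectors_def PiE_eq_empty_iff)

lemma expectation_sign_vectors:
  fixes F :: "('n::finite \<Rightarrow> real) \<Rightarrow> real"
  shows "measure_pmf.expectation (pmf_of_set (sign_vectors A)) F =
    (\<Sum>\<sigma>\<in>sign_vectors A. F \<sigma>) / real (card (sign_vectors A))"
  by (rule integral_pmf_of_set[OF sign_vectors_nonempty finite_sign_vectors])

text \<open>The uniform law is a product of fair signs, so restriction gives its marginal. The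
  default \<open>undefined\<close> matches extensionality.\<close>

lemma pmf_of_set_sign_vectors_restrict:
  "pmf_of_set (sign_vectors (A :: 'n::finite set)) =
    map_pmf (\<lambda>\<sigma>. restrict \<sigma> A) (pmf_of_set (sign_vectors UNIV))"
proof -
  have eq: "pmf_of_set (sign_vectors B) = Pi_pmf B undefined (\<lambda>_. pmf_of_set {-1, 1})"
    for B :: "'n set"
    by (subst Pi_pmf_of_set) (auto simp: sign_vectors_def PiE_dflt_def PiE_def Pi_def extensional_def
        intro!: arg_cong[of _ _ pmf_of_set])
  show ?thesis
    unfolding eq by (subst Pi_pmf_subset[of UNIV A]) (auto simp: restrict_def)
qed

lemma rademacher_mask:
  "rademacher V A = (\<Sum>\<sigma>\<in>sign_vectors UNIV. SUP v\<in>V. mask A \<sigma> \<bullet> v)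
     / real (card (sign_vectors (UNIV :: 'n set))) / real CARD('n)"
  for V :: "(real ^ 'n) set"
  by (simp add: rademacher_def pmf_of_set_sign_vectors_restrict[of A] expectation_sign_vectors mask_inner)

lemma sum_sign_vectors_flip:
  fixes F :: "('n::finite \<Rightarrow> real) \<Rightarrow> real"
  shows "(\<Sum>\<sigma>\<in>sign_vectors UNIV. F (\<sigma>(i := - \<sigma> i))) = (\<Sum>\<sigma>\<in>sign_vectors UNIV. F \<sigma>)"
  by (rule sum.reindex_bij_witness[where i = "\<lambda>\<sigma>. \<sigma>(i := - \<sigma> i)" and j = "\<lambda>\<sigma>. \<sigma>(i := - \<sigma> i)"])
    (auto simp: sign_vectors_def PiE_iff)

lemma sum_sign_vectors_maximiser_nonneg:
  fixes g :: "real ^ 'n \<Rightarrow> real ^ 'n"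
  assumes mono: "\<And>s t. 0 \<le> (s - t) \<bullet> (g s - g t)"
  shows "0 \<le> (\<Sum>\<sigma>\<in>sign_vectors UNIV. \<sigma> i * g (mask A \<sigma>) $ i)"
proof -
  define G where "G \<sigma> = \<sigma> i * g (mask A \<sigma>) $ i" for \<sigma>
  have "0 \<le> G \<sigma> + G (\<sigma>(i := - \<sigma> i))" for \<sigma>
  proof (cases "i \<in> A")
    case True
    \<comment> \<open>Only coordinate \<open>i\<close> survives, so \<open>mono\<close> gives
      exactly twice the claimed inequality.\<close>
    then have "mask A \<sigma> - mask A (\<sigma>(i := - \<sigma> i)) = axis i (2 * \<sigma> i)"
      by (auto simp: mask_def vec_eq_iff axis_def)
    with mono[of "mask A \<sigma>" "mask A (\<sigma>(i := - \<sigma> i))"] show ?thesis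
      by (simp add: G_def inner_axis' algebra_simps)
  next
    case False
    \<comment> \<open>The flip is invisible to \<open>g\<close>, so the two terms cancel.\<close>
    then have "mask A (\<sigma>(i := - \<sigma> i)) = mask A \<sigma>"
      by (auto simp: mask_def vec_eq_iff)
    then show ?thesis by (simp add: G_def)
  qed
  \<comment> \<open>Flipping permutes the sign vectors, so this is twice the sum of
    \<open>G\<close>.\<close>
  then have "0 \<le> (\<Sum>\<sigma>\<in>sign_vectors UNIV. G \<sigma> + G (\<sigma>(i := - \<sigma> i)))"
    by (simp add: sum_nonneg)
  then show ?thesis
    unfolding sum.distrib sum_sign_vectors_flip by (simp add: G_def)
qed

theorem theoremA1:
  fixes V :: "(real ^ 'n) set"
  assumes "V \<noteq> {}" and "bounded V"
  shows "XOS (rademacher V)"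
proof (rule XOS_if_supporting_weights)
  fix A :: "'n set"
  obtain g where g: "\<And>s. s \<bullet> g s = (SUP v\<in>V. s \<bullet> v)" "\<And>s t. t \<bullet> g s \<le> (SUP v\<in>V. t \<bullet> v)"
    using support_function_maximiser[OF assms] by blast
  \<comment> \<open>Add \<open>s \<bullet> g t \<le> s \<bullet> g s\<close> and
    \<open>t \<bullet> g s \<le> t \<bullet> g t\<close>.\<close>
  have mono: "0 \<le> (s - t) \<bullet> (g s - g t)" for s t
    using g(1)[of s] g(2)[of s t] g(1)[of t] g(2)[of t s] by (simp add: inner_diff)
  define N where "N = real (card (sign_vectors (UNIV :: 'n set)))"
  define w where
    "w i = (\<Sum>\<sigma>\<in>sign_vectors UNIV. \<sigma> i * g (mask A \<sigma>) $ i) / N / real CARD('n)" for i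
  have sum_w: "(\<Sum>i\<in>B. w i) =
      (\<Sum>\<sigma>\<in>sign_vectors UNIV. mask B \<sigma> \<bullet> g (mask A \<sigma>)) / N / real CARD('n)" for B
    by (simp add: w_def mask_inner sum.swap[of _ B] flip: sum_divide_distrib)
  have "0 \<le> w i" for i
    by (simp add: w_def N_def sum_sign_vectors_maximiser_nonneg[OF mono])
  moreover have "(\<Sum>i\<in>A. w i) = rademacher V A"
    by (simp add: sum_w rademacher_mask g(1) N_def)
  moreover have "(\<Sum>i\<in>B. w i) \<le> rademacher V B" for B
    unfolding sum_w rademacher_mask N_def by (intro divide_right_mono sum_mono g(2)) auto
  ultimately show "\<exists>w. (\<forall>i. 0 \<le> w i) \<and> (\<Sum>i\<in>A. w i) = rademacher V A \<and>
      (\<forall>B. (\<Sum>i\<in>B. w i) \<le> rademacher V B)"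
    by blast
qed

end
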